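(* Let $\mathcal{A}$ be an $n\times n$ (zero-nonzero) pattern, and suppose that the Nilpotent-Jacobian method successfully shows that $\mathcal{A}$ is spectrally arbitrary, using the nilpotent matrix $N\in Q(\mathcal{A})$; that is, $N\in Q(\mathcal{A})$ is nilpotent and there are $n$ distinct positions $(i_1,j_1),\ldots,(i_n,j_n)$ at which $N$ has nonzero entries $a_{i_1,j_1},\ldots,a_{i_n,j_n}$, such that the associated evaluated Jacobian matrix $J'$ (defined in the context) is nonsingular. Then $N$ has index $n$.
   Context: A (zero-nonzero) pattern of order $n$ is an $n\times n$ matrix $\mathcal{A}$ with entries in $\{*,0\}$, and $Q(\mathcal{A})=\{A\in M_n(\mathbb{R}) : A_{i,j}\neq 0 \Leftrightarrow \mathcal{A}_{i,j}=* \text{ for all } i,j\}$. A pattern is spectrally arbitrary if every self-conjugate multiset of $n$ complex numbers is the spectrum of some $A\in Q(\mathcal{A})$. The index of a nilpotent matrix $N$ is the smallest positive integer $k$ with $N^k=0$. Nilpotent-Jacobian method: let $N\in Q(\mathcal{A})$ be nilpotent with at least $n$ nonzero entries, and choose $n$ of them, in distinct positions $(i_1,j_1),\ldots,(i_n,j_n)$, with values $a_{i_1,j_1},\ldots,a_{i_n,j_n}$. Let $X=X(x_1,\ldots,x_n)$ be the matrix obtained from $N$ by replacing the $(i_k,j_k)$ entry by the variable $x_k$ for $k=1,\ldots,n$. Write its characteristic polynomial as $p_X(x)=\det(xI-X)=x^n+f_1x^{n-1}+f_2x^{n-2}+\cdots+f_{n-1}x+f_n$, where each $f_i=f_i(x_1,\ldots,x_n)$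 is a polynomial in $x_1,\ldots,x_n$. Let $J$ be the $n\times n$ Jacobian matrix with $(i,k)$ entry $\partial f_i/\partial x_k$, and let $J'=J|_{(x_1,\ldots,x_n)=(a_{i_1,j_1},\ldots,a_{i_n,j_n})}$. The method succeeds (and shows $\mathcal{A}$ is spectrally arbitrary) when $J'$ is nonsingular for some such choice of $N$ and of positions. *)

theory Defs
  imports "HOL-Analysis.Derivative" "Jordan_Normal_Form.Char_Poly"
begin

datatype pattern_entry = Star | Zero

definition pattern_class :: "pattern_entry mat \<Rightarrow> real mat set" where
  "pattern_class P = {A \<in> carrier_mat (dim_row P) (dim_col P).
     \<forall>i < dim_row P. \<forall>j < dim_col P. A $$ (i, j) \<noteq> 0 \<longleftrightarrow> P $$ (i, j) = Star}"

definition nilpotent_mat :: "'a::semiring_1 mat \<Rightarrow> bool" where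
  "nilpotent_mat N \<longleftrightarrow> square_mat N \<and>
     (\<exists>k>0. N ^\<^sub>m k = 0\<^sub>m (dim_row N) (dim_row N))"

text \<open>Only meaningful for nilpotent matrices.\<close>

definition nilpotency_index :: "'a::semiring_1 mat \<Rightarrow> nat" where
  "nilpotency_index N = (LEAST k. k > 0 \<and> N ^\<^sub>m k = 0\<^sub>m (dim_row N) (dim_row N))"

text \<open>Matrix entries, positions \<open>pos k\<close> and variables \<open>x k\<close> are all indexed from \<open>0\<close>
  (so \<open>k < n\<close> where \<open>n = dim_row N\<close>).  The definition is meant for \<open>pos\<close> injective
  on \<open>{..<n}\<close>, which makes \<open>the_inv_into\<close> pick the \<open>k\<close> with \<open>pos k = (i, j)\<close>.\<close>

definition replace_entries :: "real mat \<Rightarrow> (nat \<Rightarrow> nat \<times> nat) \<Rightarrow> (nat \<Rightarrow> real) \<Rightarrow> real mat" where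
  "replace_entries N pos x = (let n = dim_row N in
     mat n n (\<lambda>(i, j). if (i, j) \<in> pos ` {..<n}
                       then x (the_inv_into {..<n} pos (i, j)) else N $$ (i, j)))"

text \<open>The functions \<open>f\<^sub>1, \<dots>, f\<^sub>n\<close> are numbered from \<open>1\<close>: \<open>f\<^sub>i\<close> is the coefficient
  of degree \<open>n - i\<close> of the characteristic polynomial \<open>det (x I - X)\<close>.\<close>

definition charpoly_coeff :: "real mat \<Rightarrow> (nat \<Rightarrow> nat \<times> nat) \<Rightarrow> nat \<Rightarrow> (nat \<Rightarrow> real) \<Rightarrow> real" where
  "charpoly_coeff N pos i x = coeff (char_poly (replace_entries N pos x)) (dim_row N - i)"

definition partial_deriv :: "((nat \<Rightarrow> real) \<Rightarrow> real) \<Rightarrow> nat \<Rightarrow> (nat \<Rightarrow> real) \<Rightarrow> real" where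
  "partial_deriv f k x = deriv (\<lambda>t. f (x(k := t))) (x k)"

text \<open>Row \<open>i\<close>, counted from \<open>0\<close>, belongs to \<open>f\<^bsub>i+1\<^esub>\<close>.\<close>

definition coeff_jacobian :: "real mat \<Rightarrow> (nat \<Rightarrow> nat \<times> nat) \<Rightarrow> (nat \<Rightarrow> real) \<Rightarrow> real mat" where
  "coeff_jacobian N pos x = mat (dim_row N) (dim_row N)
     (\<lambda>(i, k). partial_deriv (charpoly_coeff N pos (i + 1)) k x)"

end

theory Submission
  imports Defs
begin

text \<open>
  Let \<open>N\<close> be nilpotent of order \<open>n\<close> and index \<open>m\<close>, and let \<open>adj\<close> denote the adjugate.
  The coefficients \<open>f\<^sub>i\<close> are affine functions of any single matrix entry: expanding
  \<open>det (xI - X)\<close> along row \<open>a\<close> shows that the slope in the entry \<open>(a, b)\<close> is minus the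
  coefficient of \<open>x\<^bsup>n-i\<^esup>\<close> in the entry \<open>(b, a)\<close> of \<open>adj (xI - N)\<close>
  (\<open>partial_deriv_charpoly_coeff\<close>). Hence the last row of the Jacobian, that of \<open>f\<^sub>n\<close>,
  consists of negated constant terms of entries of \<open>adj (xI - N)\<close>.

  Everything else follows from an explicit form of this adjugate. As \<open>N\<^sup>m = 0\<close>, the finite
  geometric sum \<open>S = x\<^bsup>m-1\<^esup> I + x\<^bsup>m-2\<^esup> N + \<dots> + N\<^bsup>m-1\<^esup>\<close> satisfies \<open>(xI - N) S = x\<^sup>m I\<close>.
  Taking determinants, the characteristic polynomial divides a power of \<open>x\<close>, so it is \<open>x\<^sup>n\<close>.
  Multiplying from the left by the adjugate gives
  \<open>x\<^sup>m adj (xI - N) = x\<^sup>n S\<close> (\<open>adj_char_poly_matrix_nilpotent\<close>). Now compare \<open>m\<close> and \<open>n\<close>: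

  \<^item> if \<open>m > n\<close>, then \<open>S = x\<^bsup>m-n\<^esup> adj (xI - N)\<close> vanishes at \<open>x = 0\<close>; but its value
    there is \<open>N\<^bsup>m-1\<^esup>\<close>, against the minimality of \<open>m\<close> (\<open>pow_pred_eq_0_if_gt_dim\<close>);
  \<^item> if \<open>m < n\<close>, then \<open>adj (xI - N) = x\<^bsup>n-m\<^esup> S\<close> vanishes at \<open>x = 0\<close>, so the last
    row of the Jacobian is zero and the Jacobian is singular
    (\<open>poly_0_adj_char_poly_matrix\<close>).
\<close>

section \<open>The adjugate of the characteristic matrix of a nilpotent matrix\<close>

text \<open>The sum \<open>x\<^bsup>k-1\<^esup> I + x\<^bsup>k-2\<^esup> B + \<dots> + B\<^bsup>k-1\<^esup>\<close>, written as a Horner recursion in \<open>x\<close>: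
  this way the telescoping identity below is a plain induction, and setting \<open>x = 0\<close> leaves
  exactly the last summand when \<open>k > 0\<close>.\<close>

primrec geom_sum_mat :: "'a::comm_ring_1 mat \<Rightarrow> 'a \<Rightarrow> nat \<Rightarrow> 'a mat" where
  "geom_sum_mat B x 0 = 0\<^sub>m (dim_row B) (dim_row B)"
| "geom_sum_mat B x (Suc k) = x \<cdot>\<^sub>m geom_sum_mat B x k + B ^\<^sub>m k"

lemma geom_sum_mat_carrier [simp]:
  "B \<in> carrier_mat n n \<Longrightarrow> geom_sum_mat B x k \<in> carrier_mat n n"
  by (induction k) auto

lemma mult_pow_mat_commute:
  assumes B: "B \<in> carrier_mat n n"
  shows "B * B ^\<^sub>m k = B ^\<^sub>m k * B"
proof (induction k)
  case 0
  show ?case using B by simp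
next
  case (Suc k)
  have "B * (B ^\<^sub>m k * B) = (B * B ^\<^sub>m k) * B"
    using B by (simp add: assoc_mult_mat[of _ n n _ n _ n])
  then show ?case by (simp add: Suc)
qed

lemma mult_geom_sum_mat:
  assumes B: "B \<in> carrier_mat n n"
  shows "(x \<cdot>\<^sub>m 1\<^sub>m n - B) * geom_sum_mat B x k = x ^ k \<cdot>\<^sub>m 1\<^sub>m n - B ^\<^sub>m k"
proof (induction k)
  case 0
  show ?case using B by (auto intro!: eq_matI)
next
  case (Suc k)
  let ?M = "x \<cdot>\<^sub>m 1\<^sub>m n - B" and ?S = "geom_sum_mat B x k"
  have M: "?M \<in> carrier_mat n n" using B by auto
  have S: "?S \<in> carrier_mat n n" and P: "B ^\<^sub>m k \<in> carrier_mat n n" using B by auto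
  have comm: "B * B ^\<^sub>m k = B ^\<^sub>m k * B"
    by (rule mult_pow_mat_commute[OF B])
  have "?M * geom_sum_mat B x (Suc k) = x \<cdot>\<^sub>m (?M * ?S) + ?M * B ^\<^sub>m k"
    using mult_add_distrib_mat[OF M smult_carrier_mat[OF S] P] mult_smult_distrib[OF M S]
    by simp
  also have "\<dots> = x \<cdot>\<^sub>m (x ^ k \<cdot>\<^sub>m 1\<^sub>m n - B ^\<^sub>m k) + (x \<cdot>\<^sub>m B ^\<^sub>m k - B * B ^\<^sub>m k)"
    using B by (simp add: Suc minus_mult_distrib_mat[OF smult_carrier_mat[OF one_carrier_mat] B P]
        mult_smult_assoc_mat[OF one_carrier_mat P])
  also have "\<dots> = x ^ Suc k \<cdot>\<^sub>m 1\<^sub>m n - B ^\<^sub>m Suc k"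
    using B P by (intro eq_matI) (auto simp: comm algebra_simps)
  finally show ?case .
qed

text \<open>Over the polynomial ring the characteristic matrix has the form \<open>x I - B\<close> with \<open>B\<close> the
  matrix of constant polynomials, so the geometric sum applies to it with \<open>x\<close> the
  indeterminate.\<close>

lemma char_poly_matrix_eq:
  assumes "A \<in> carrier_mat n n"
  shows "char_poly_matrix A = [:0, 1:] \<cdot>\<^sub>m 1\<^sub>m n - map_mat (\<lambda>a. [:a:]) A"
  using assms by (auto simp: char_poly_matrix_def intro!: eq_matI)

lemma map_mat_const_poly_pow:
  fixes A :: "'a::comm_ring_1 mat"
  assumes A: "A \<in> carrier_mat n n"
  shows "map_mat (\<lambda>a. [:a:]) A ^\<^sub>m k = map_mat (\<lambda>a. [:a:]) (A ^\<^sub>m k)"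
proof -
  interpret semiring_hom "\<lambda>a::'a. [:a:]" by unfold_locales (auto simp: one_pCons)
  show ?thesis using mat_hom_pow[OF A] by simp
qed

lemma char_poly_matrix_mult_geom_sum_mat:
  fixes A :: "'a::comm_ring_1 mat"
  assumes A: "A \<in> carrier_mat n n" and nil: "A ^\<^sub>m m = 0\<^sub>m n n"
  shows "char_poly_matrix A * geom_sum_mat (map_mat (\<lambda>a. [:a:]) A) [:0, 1:] m
    = [:0, 1:] ^ m \<cdot>\<^sub>m 1\<^sub>m n"
proof -
  have z: "map_mat (\<lambda>a. [:a:]) A ^\<^sub>m m = 0\<^sub>m n n"
    using nil by (auto simp: map_mat_const_poly_pow[OF A] intro!: eq_matI)
  show ?thesis using A
    by (simp add: char_poly_matrix_eq mult_geom_sum_mat z) (auto intro!: eq_matI)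
qed

text \<open>Counting roots at \<open>0\<close>: if \<open>x\<^sup>m = p q\<close>, the orders of \<open>p\<close> and \<open>q\<close> at \<open>0\<close> add up to
  \<open>m\<close>, and so do their degrees. An order never exceeds the degree, so for \<open>p\<close> the
  two agree, and splitting off the root \<open>0\<close> leaves only the leading coefficient.\<close>

lemma monic_dvd_linear_power:
  fixes p :: "'a::idom poly"
  assumes "monic p" "p dvd [:0, 1:] ^ m"
  shows "p = [:0, 1:] ^ degree p"
proof -
  let ?X = "[:0, 1::'a:]"
  obtain q where q: "?X ^ m = p * q" using assms(2) by blast
  then have pq: "p * q \<noteq> 0" by (metis pCons_eq_0_iff power_not_zero zero_neq_one)
  then have nz: "p \<noteq> 0" "q \<noteq> 0" by auto
  have "order 0 p + order 0 q = m"
    using order_mult[OF pq] order_power_n_n[of "0::'a" m] q by simp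
  moreover have "degree p + degree q = m"
    using degree_mult_eq[OF nz] q by (metis degree_linear_power)
  ultimately have "order 0 p = degree p"
    using order_degree[OF nz(1), of 0] order_degree[OF nz(2), of 0] by linarith
  then have "?X ^ degree p dvd p" using order_1[of 0 p] by simp
  then obtain r where r: "p = ?X ^ degree p * r" by blast
  with nz have "r \<noteq> 0" by auto
  have "degree p = degree p + degree r"
    using r degree_mult_eq[of "?X ^ degree p" r] \<open>r \<noteq> 0\<close> degree_linear_power[of "0::'a" "degree p"]
    by (metis mult_zero_left nz(1))
  then obtain c where c: "r = [:c:]" by (metis add_cancel_left_right degree_eq_zeroE)
  have "lead_coeff p = lead_coeff (?X ^ degree p) * c"
    using arg_cong[OF r, of lead_coeff] by (simp add: c lead_coeff_mult)
  then have "c = 1" using assms(1) by (simp add: lead_coeff_power)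
  with r c show ?thesis by simp
qed

text \<open>The determinant of \<open>(xI - A) S = x\<^sup>m I\<close> exhibits the characteristic polynomial as a monic
  divisor of a power of \<open>x\<close>. This argument stays within the coefficient ring, where a proof by
  eigenvalues would pass to a splitting field.\<close>

lemma char_poly_nilpotent:
  fixes A :: "'a::idom mat"
  assumes A: "A \<in> carrier_mat n n" and nil: "A ^\<^sub>m m = 0\<^sub>m n n"
  shows "char_poly A = [:0, 1:] ^ n"
proof -
  let ?S = "geom_sum_mat (map_mat (\<lambda>a. [:a:]) A) [:0, 1:] m"
  have "char_poly A * det ?S = det ([:0, 1:] ^ m \<cdot>\<^sub>m 1\<^sub>m n)"
    using A det_mult[of "char_poly_matrix A" n ?S]
    by (simp add: char_poly_def char_poly_matrix_mult_geom_sum_mat[OF A nil])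
  also have "\<dots> = [:0, 1:] ^ (m * n)" by (simp add: power_mult)
  finally have "char_poly A dvd [:0, 1:] ^ (m * n)" by (metis dvd_triv_left)
  with degree_monic_char_poly[OF A] monic_dvd_linear_power show ?thesis by metis
qed

text \<open>Both sides are \<open>adj (xI - A) (xI - A) S\<close>, bracketed in the two possible ways.\<close>

lemma adj_char_poly_matrix_nilpotent:
  fixes A :: "'a::idom mat"
  assumes A: "A \<in> carrier_mat n n" and nil: "A ^\<^sub>m m = 0\<^sub>m n n"
  shows "[:0, 1:] ^ m \<cdot>\<^sub>m adj_mat (char_poly_matrix A)
    = [:0, 1:] ^ n \<cdot>\<^sub>m geom_sum_mat (map_mat (\<lambda>a. [:a:]) A) [:0, 1:] m"
proof -
  let ?M = "char_poly_matrix A" and ?S = "geom_sum_mat (map_mat (\<lambda>a. [:a:]) A) [:0, 1:] m"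
  have M: "?M \<in> carrier_mat n n" and S: "?S \<in> carrier_mat n n" using A by auto
  note adj = adj_mat[OF M]
  have "[:0, 1:] ^ m \<cdot>\<^sub>m adj_mat ?M = adj_mat ?M * (?M * ?S)"
    using adj(1) mult_smult_distrib[OF adj(1) one_carrier_mat]
    by (simp add: char_poly_matrix_mult_geom_sum_mat[OF A nil])
  also have "\<dots> = (adj_mat ?M * ?M) * ?S"
    using adj(1) M S by (simp add: assoc_mult_mat[of _ n n _ n _ n])
  also have "\<dots> = [:0, 1:] ^ n \<cdot>\<^sub>m ?S"
    using S char_poly_nilpotent[OF A nil]
    by (simp add: adj(3) mult_smult_assoc_mat[of _ n n] flip: char_poly_def)
  finally show ?thesis .
qed

corollary adj_char_poly_matrix_nilpotent_entry:
  fixes A :: "'a::idom mat"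
  assumes A: "A \<in> carrier_mat n n" and nil: "A ^\<^sub>m m = 0\<^sub>m n n" and ij: "i < n" "j < n"
  shows "[:0, 1:] ^ m * adj_mat (char_poly_matrix A) $$ (i, j)
    = [:0, 1:] ^ n * geom_sum_mat (map_mat (\<lambda>a. [:a:]) A) [:0, 1:] m $$ (i, j)"
proof -
  have "adj_mat (char_poly_matrix A) \<in> carrier_mat n n"
    using A by (intro adj_mat(1)) simp
  moreover have "geom_sum_mat (map_mat (\<lambda>a. [:a:]) A) [:0, 1:] m \<in> carrier_mat n n"
    using A by (intro geom_sum_mat_carrier) simp
  ultimately show ?thesis
    using arg_cong[OF adj_char_poly_matrix_nilpotent[OF A nil], of "\<lambda>X. X $$ (i, j)"] ij
    by simp
qed

lemma poly_0_geom_sum_mat: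
  fixes A :: "'a::comm_ring_1 mat"
  assumes A: "A \<in> carrier_mat n n" and "i < n" "j < n"
  shows "poly (geom_sum_mat (map_mat (\<lambda>a. [:a:]) A) [:0, 1:] (Suc k) $$ (i, j)) 0
    = (A ^\<^sub>m k) $$ (i, j)"
proof -
  have "geom_sum_mat (map_mat (\<lambda>a. [:a:]) A) [:0, 1:] k \<in> carrier_mat n n"
    using A by simp
  note dims = carrier_matD[OF this]
  show ?thesis using assms by (auto simp: map_mat_const_poly_pow[OF A] dims)
qed

text \<open>The power of \<open>x\<close> in front of the adjugate is larger than the one in front of the
  geometric sum. Cancelling the smaller one leaves the geometric sum divisible by \<open>x\<close>, and its
  constant term is \<open>A\<^sup>k\<close>. Repeated use gives \<open>A\<^sup>n = 0\<close>.\<close>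

lemma pow_pred_eq_0_if_gt_dim:
  fixes A :: "'a::idom mat"
  assumes A: "A \<in> carrier_mat n n" and nil: "A ^\<^sub>m Suc k = 0\<^sub>m n n" and "n < Suc k"
  shows "A ^\<^sub>m k = 0\<^sub>m n n"
proof (rule eq_matI)
  fix i j assume "i < dim_row (0\<^sub>m n n :: 'a mat)" "j < dim_col (0\<^sub>m n n :: 'a mat)"
  then have ij: "i < n" "j < n" by auto
  let ?a = "adj_mat (char_poly_matrix A) $$ (i, j)"
  let ?s = "geom_sum_mat (map_mat (\<lambda>a. [:a:]) A) [:0, 1:] (Suc k) $$ (i, j)"
  have "[:0, 1:] ^ Suc k * ?a = [:0, 1:] ^ n * ?s"
    by (rule adj_char_poly_matrix_nilpotent_entry[OF A nil ij])
  moreover have "[:0, 1::'a:] ^ Suc k = [:0, 1:] ^ n * [:0, 1:] ^ (Suc k - n)"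
    using \<open>n < Suc k\<close> by (simp flip: power_add)
  ultimately have "?s = [:0, 1:] ^ (Suc k - n) * ?a"
    by (simp add: mult.assoc del: geom_sum_mat.simps power_Suc)
  then have "poly ?s 0 = 0" using \<open>n < Suc k\<close> by (simp del: geom_sum_mat.simps)
  then show "(A ^\<^sub>m k) $$ (i, j) = 0\<^sub>m n n $$ (i, j)"
    using poly_0_geom_sum_mat[OF A ij, of k] ij by simp
qed (use A in auto)

text \<open>The opposite comparison: a vanishing power below the order leaves a factor \<open>x\<close> in every entry of
  the adjugate. Up to sign, this says that all cofactors of \<open>A\<close> are zero.\<close>

lemma poly_0_adj_char_poly_matrix:
  fixes A :: "'a::idom mat"
  assumes A: "A \<in> carrier_mat n n" and nil: "A ^\<^sub>m m = 0\<^sub>m n n" and "m < n"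
    and ij: "i < n" "j < n"
  shows "poly (adj_mat (char_poly_matrix A) $$ (i, j)) 0 = 0"
proof -
  let ?a = "adj_mat (char_poly_matrix A) $$ (i, j)"
  let ?s = "geom_sum_mat (map_mat (\<lambda>a. [:a:]) A) [:0, 1:] m $$ (i, j)"
  have "[:0, 1:] ^ m * ?a = [:0, 1:] ^ n * ?s"
    by (rule adj_char_poly_matrix_nilpotent_entry[OF A nil ij])
  moreover have "[:0, 1::'a:] ^ n = [:0, 1:] ^ m * [:0, 1:] ^ (n - m)"
    using \<open>m < n\<close> by (simp flip: power_add)
  ultimately have "?a = [:0, 1:] ^ (n - m) * ?s"
    by (simp add: mult.assoc)
  then show ?thesis using \<open>m < n\<close> by simp
qed

section \<open>The coefficient Jacobian\<close>

text \<open>Changing the entry \<open>(a, b)\<close> does not affect the cofactors along row \<open>a\<close>, so in the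
  expansion along that row exactly one term changes. The two indices are swapped because the
  adjugate is the transposed matrix of cofactors.\<close>

lemma char_poly_update_entry:
  fixes A B :: "'a::comm_ring_1 mat"
  assumes A: "A \<in> carrier_mat n n" and B: "B \<in> carrier_mat n n" and ab: "a < n" "b < n"
    and eq: "\<And>i j. i < n \<Longrightarrow> j < n \<Longrightarrow> (i, j) \<noteq> (a, b) \<Longrightarrow> B $$ (i, j) = A $$ (i, j)"
  shows "char_poly B = char_poly A
    - [:B $$ (a, b) - A $$ (a, b):] * adj_mat (char_poly_matrix A) $$ (b, a)"
proof -
  let ?A = "char_poly_matrix A" and ?B = "char_poly_matrix B"
  have cA: "?A \<in> carrier_mat n n" and cB: "?B \<in> carrier_mat n n" using A B by auto
  have entry: "?B $$ (i, j) = ?A $$ (i, j)" if "i < n" "j < n" "(i, j) \<noteq> (a, b)" for i j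
    using that A B eq[OF that] by (simp add: char_poly_matrix_def)
  have cof: "cofactor ?B a j = cofactor ?A a j" if "j < n" for j
  proof -
    have "mat_delete ?B a j = mat_delete ?A a j"
      using cA cB that by (intro eq_matI) (auto simp: mat_delete_def intro!: entry)
    then show ?thesis by (simp add: cofactor_def)
  qed
  have "char_poly B = (\<Sum>j<n. ?B $$ (a, j) * cofactor ?A a j)"
    using laplace_expansion_row[OF cB ab(1)] by (simp add: char_poly_def cof)
  also have "\<dots> = (\<Sum>j<n. ?A $$ (a, j) * cofactor ?A a j
      + (if j = b then (?B $$ (a, b) - ?A $$ (a, b)) * cofactor ?A a b else 0))"
    using entry ab by (intro sum.cong) (auto simp: algebra_simps)
  also have "\<dots> = char_poly A + (?B $$ (a, b) - ?A $$ (a, b)) * cofactor ?A a b"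
    using laplace_expansion_row[OF cA ab(1)] ab
    by (simp add: char_poly_def sum.distrib)
  also have "?B $$ (a, b) - ?A $$ (a, b) = - [:B $$ (a, b) - A $$ (a, b):]"
    using A B ab by (simp add: char_poly_matrix_def)
  also have "cofactor ?A a b = adj_mat ?A $$ (b, a)"
    using cA ab by (simp add: adj_mat_def)
  finally show ?thesis
    by (simp only: mult_minus_left diff_conv_add_uminus)
qed

text \<open>At the entries of \<open>N\<close> itself, moving the variable \<open>k\<close> amounts to changing the single
  entry \<open>pos k\<close> of \<open>N\<close>, so each coefficient is an affine function of that variable.\<close>

lemma partial_deriv_charpoly_coeff:
  assumes N: "N \<in> carrier_mat n n" and pos: "pos ` {..<n} \<subseteq> {..<n} \<times> {..<n}"
    and inj: "inj_on pos {..<n}" and k: "k < n"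
  shows "partial_deriv (charpoly_coeff N pos i) k (\<lambda>l. N $$ pos l)
    = - coeff (adj_mat (char_poly_matrix N) $$ (snd (pos k), fst (pos k))) (n - i)"
proof -
  obtain a b where ab: "pos k = (a, b)" "a < n" "b < n"
    using pos k by fastforce
  let ?x = "\<lambda>l. N $$ pos l" and ?c = "coeff (adj_mat (char_poly_matrix N) $$ (b, a)) (n - i)"
  have "charpoly_coeff N pos i (?x(k := t))
      = coeff (char_poly N) (n - i) - (t - N $$ (a, b)) * ?c" for t
  proof -
    let ?R = "replace_entries N pos (?x(k := t))"
    have R: "?R \<in> carrier_mat n n" using N by (simp add: replace_entries_def)
    have inv: "the_inv_into {..<n} pos (pos l) = l" if "l < n" for l
      using that by (simp add: the_inv_into_f_f inj)
    have "(a, b) \<in> pos ` {..<n}" using ab k by (metis imageI lessThan_iff)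
    then have "?R $$ (a, b) = t"
      using N ab inv[OF k] by (simp add: replace_entries_def)
    moreover have "?R $$ (i, j) = N $$ (i, j)" if "i < n" "j < n" "(i, j) \<noteq> (a, b)" for i j
      using N ab that inv by (auto simp: replace_entries_def)
    ultimately have "char_poly ?R
        = char_poly N - [:t - N $$ (a, b):] * adj_mat (char_poly_matrix N) $$ (b, a)"
      using char_poly_update_entry[OF N R ab(2,3)] by simp
    then show ?thesis using N by (simp add: charpoly_coeff_def)
  qed
  moreover have "((\<lambda>t. coeff (char_poly N) (n - i) - (t - N $$ (a, b)) * ?c)
      has_real_derivative - ?c) (at (?x k))"
    by (auto intro!: derivative_eq_intros)
  ultimately show ?thesis
    using ab by (simp add: partial_deriv_def DERIV_imp_deriv)
qed

lemma not_invertible_zero_row: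
  assumes A: "A \<in> carrier_mat n n" and i: "i < n" and z: "\<And>j. j < n \<Longrightarrow> A $$ (i, j) = 0"
  shows "\<not> invertible_mat (A :: 'a::comm_ring_1 mat)"
proof
  assume "invertible_mat A"
  then obtain B where B: "A * B = 1\<^sub>m n" and "B * A = 1\<^sub>m (dim_row B)"
    using A by (auto simp: invertible_mat_def inverts_mat_def)
  then have "dim_col B = n" "dim_row B = n"
    using A by (metis index_mult_mat(3) index_one_mat(3) carrier_matD(2))+
  then have "(A * B) $$ (i, i) = 0"
    using A i z by (simp add: scalar_prod_def)
  then show False using B i by simp
qed

section \<open>The index of the nilpotent matrix\<close>

theorem theorem5p8:
  fixes n :: nat
    and P :: "pattern_entry mat"
    and N :: "real mat"
    and pos :: "nat \<Rightarrow> nat \<times> nat"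
  assumes "n \<ge> 1"
    and "P \<in> carrier_mat n n"
    and "N \<in> pattern_class P"
    and "nilpotent_mat N"
    and "pos ` {..<n} \<subseteq> {..<n} \<times> {..<n}"
    and "inj_on pos {..<n}"
    and "\<And>k. k < n \<Longrightarrow> N $$ pos k \<noteq> 0"
    and "invertible_mat (coeff_jacobian N pos (\<lambda>k. N $$ pos k))"
  shows "nilpotency_index N = n"
proof -
  have N: "N \<in> carrier_mat n n"
    using assms(2,3) by (auto simp: pattern_class_def)
  define Q where "Q = (\<lambda>k. k > 0 \<and> N ^\<^sub>m k = 0\<^sub>m n n)"
  define m where "m = nilpotency_index N"
  have m_def': "m = (LEAST k. Q k)"
    using N by (simp add: m_def nilpotency_index_def Q_def)
  have "\<exists>k. Q k"
    using assms(4) N by (auto simp: nilpotent_mat_def Q_def)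
  then have "Q m"
    unfolding m_def' by (rule LeastI_ex)
  then have nil: "N ^\<^sub>m m = 0\<^sub>m n n" and "m > 0" by (auto simp: Q_def)
  have "\<not> n < m"
  proof
    assume "n < m"
    then obtain k where k: "m = Suc k" by (cases m) auto
    have "N ^\<^sub>m k = 0\<^sub>m n n"
      using pow_pred_eq_0_if_gt_dim[OF N] nil \<open>n < m\<close> k by simp
    \<comment> \<open>The index is a positive number by definition; \<open>k\<close> qualifies because \<open>k \<ge> n \<ge> 1\<close>.\<close>
    with \<open>n < m\<close> \<open>n \<ge> 1\<close> k have "Q k" by (auto simp: Q_def)
    then show False using k not_less_Least[of k Q] m_def' by simp
  qed
  moreover have "\<not> m < n"
  proof
    assume "m < n"
    \<comment> \<open>Row \<open>n - 1\<close> belongs to \<open>f\<^sub>n\<close>, the coefficient of degree \<open>0\<close>.\<close>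
    have "coeff_jacobian N pos (\<lambda>k. N $$ pos k) $$ (n - 1, k) = 0" if k: "k < n" for k
    proof -
      have "pos k \<in> {..<n} \<times> {..<n}" using assms(5) k by blast
      then show ?thesis
        using N k \<open>n \<ge> 1\<close> poly_0_adj_char_poly_matrix[OF N nil \<open>m < n\<close>]
        by (auto simp: coeff_jacobian_def partial_deriv_charpoly_coeff[OF N assms(5,6) k]
            poly_0_coeff_0)
    qed
    then have "\<not> invertible_mat (coeff_jacobian N pos (\<lambda>k. N $$ pos k))"
      using N \<open>n \<ge> 1\<close>
      by (intro not_invertible_zero_row[where n = n and i = "n - 1"]) (auto simp: coeff_jacobian_def)
    with assms(8) show False by contradiction
  qed
  ultimately show ?thesis by (simp add: m_def)
qed

end
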